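(* Let $p\in(0,1)$. For every integer $n\geq 0$ and every $x>0$, $$m_p^{(n)}(x)=\sum_{k=0}^n\binom{n}{k}(-\log p)^{-k}\,p_k\!\left(-\frac{\log p}{x}\right)e^{\frac{\log p}{x}}\,u_p^{(n-k)}(x).$$
   Context: For $p\in(0,1)$ and $x>0$, $m_p(x)>0$ denotes the $p$-quantile of the gamma distribution with shape parameter $x$ and scale parameter $1$, i.e. the unique positive number with $\int_0^{m_p(x)}e^{-t}t^{x-1}\,dt=p\,\Gamma(x)$. (The function $m_p$ is $C^\infty$ on $(0,\infty)$.) Define $u_p(x)=e^{-\frac{\log p}{x}}m_p(x)$ for $x>0$. The polynomials $p_k$ are defined by $\frac{d^k}{dx^k}\left(e^{-1/x}\right)=p_k(1/x)e^{-1/x}$ for $x>0$, $k\geq 0$; in particular $p_0=1$. (The polynomials $p_k$ are not to be confused with the number $p$.) *)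

theory Defs
  imports "HOL-Analysis.Analysis" "HOL-Computational_Algebra.Polynomial"
begin

text \<open>
  The integrand is set to \<open>0\<close> at \<open>t = 0\<close> by the convention \<open>0 powr a = 0\<close>; for \<open>0 < x < 1\<close> it is
  unbounded near \<open>0\<close>, and the gauge integral over \<open>{0..y}\<close> is the usual improper integral.
  The description is meaningful for \<open>0 < p < 1\<close> and \<open>x > 0\<close> only.
\<close>

definition gamma_quantile :: "real \<Rightarrow> real \<Rightarrow> real" where
  "gamma_quantile p x =
     (THE y. 0 < y \<and> integral {0..y} (\<lambda>t. exp (- t) * t powr (x - 1)) = p * Gamma x)"

definition scaled_quantile :: "real \<Rightarrow> real \<Rightarrow> real" where
  "scaled_quantile p x = exp (- (ln p / x)) * gamma_quantile p x"

definition exp_inv_poly :: "nat \<Rightarrow> real poly" where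
  "exp_inv_poly k =
     (THE q. \<forall>x>0. (deriv ^^ k) (\<lambda>y. exp (- (1 / y))) x = poly q (1 / x) * exp (- (1 / x)))"

end

theory Submission
  imports Defs
begin

text \<open>
  Write \<open>m\<close> for the quantile, \<open>u\<close> for the scaled quantile and $c = -\log p > 0$. By definition
  $m(x) = e^{-c/x} u(x)$, and $e^{-c/x} = g(x/c)$ with $g(x) = e^{-1/x}$ has the \<open>k\<close>-th
  derivative $c^{-k} p_k(c/x) e^{-c/x}$. The formula is the Leibniz rule for this product.

  What needs work is that the iterated derivatives exist, that is, that \<open>m\<close> is smooth. The
  incomplete gamma function is $y^x H_1(x,y)$ with the entire series
  $H_j(x,y) = \sum_n (-y)^n / (n!\,(x+n)^j)$, whose partial derivatives belong to the same family:
  $\partial_x H_j = -j H_{j+1}$ and $\partial_y H_j(x,y) = -H_j(x+1,y)$. The quantile is the unique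
  solution of $m^x H_1(x,m) = p\,\Gamma(x)$; it is continuous by monotonicity, and implicit
  differentiation (\<open>gamma_quantile_derivative\<close>) gives
  $$m' = m\, e^m \left((\psi(x) - \ln m) H_1(x,m) + H_2(x,m)\right),$$
  where $\psi$ is the digamma function. Therefore \<open>m\<close>, $\ln m$, $e^m$, the polygamma functions
  and the functions $H_j(x+i,m(x))$ generate a ring of functions in which the derivative of every
  generator lies again (\<open>closed_under_deriv_quantile_generators\<close>). Every member of such a ring is
  smooth (\<open>has_real_derivative_higher_deriv\<close>), without any estimate on higher derivatives.
  Adjoining $1/x$ and $e^{c/x}$ puts \<open>u\<close> into the ring too.
\<close>

section \<open>Function rings closed under differentiation\<close>

inductive_set ring_span :: "(real \<Rightarrow> real) set \<Rightarrow> (real \<Rightarrow> real) set" for G where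
  gen: "g \<in> G \<Longrightarrow> g \<in> ring_span G"
| const: "(\<lambda>x. c) \<in> ring_span G"
| add: "f \<in> ring_span G \<Longrightarrow> g \<in> ring_span G \<Longrightarrow> (\<lambda>x. f x + g x) \<in> ring_span G"
| mult: "f \<in> ring_span G \<Longrightarrow> g \<in> ring_span G \<Longrightarrow> (\<lambda>x. f x * g x) \<in> ring_span G"

definition closed_under_deriv :: "(real \<Rightarrow> real) set \<Rightarrow> bool" where
  "closed_under_deriv A \<longleftrightarrow>
     (\<forall>f\<in>A. \<exists>f'\<in>A. \<forall>x>0. (f has_real_derivative f' x) (at x))"

text \<open>
  By the Leibniz rule it is enough to differentiate the generators. In this way smoothness of a
  function follows from first derivatives alone: one exhibits a system of first-order differential
  equations with polynomial right-hand sides which the function and its companions satisfy.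
\<close>

lemma closed_under_deriv_ring_span:
  assumes "\<And>g. g \<in> G \<Longrightarrow> \<exists>g'\<in>ring_span G. \<forall>x>0. (g has_real_derivative g' x) (at x)"
  shows "closed_under_deriv (ring_span G)"
  unfolding closed_under_deriv_def
proof
  fix f assume "f \<in> ring_span G"
  then show "\<exists>f'\<in>ring_span G. \<forall>x>0. (f has_real_derivative f' x) (at x)"
  proof induction
    case (gen g)
    then show ?case by (rule assms)
  next
    case (const c)
    show ?case by (rule bexI[OF _ ring_span.const[of 0]]) simp
  next
    case (add f g)
    then obtain f' g' where *: "f' \<in> ring_span G" "\<forall>x>0. (f has_real_derivative f' x) (at x)"
        "g' \<in> ring_span G" "\<forall>x>0. (g has_real_derivative g' x) (at x)"
      by blast
    then have "\<forall>x>0. ((\<lambda>x. f x + g x) has_real_derivative f' x + g' x) (at x)"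
      by (auto intro: DERIV_add)
    moreover have "(\<lambda>x. f' x + g' x) \<in> ring_span G"
      using * by (intro ring_span.add)
    ultimately show ?case by (intro bexI)
  next
    case (mult f g)
    then obtain f' g' where *: "f' \<in> ring_span G" "\<forall>x>0. (f has_real_derivative f' x) (at x)"
        "g' \<in> ring_span G" "\<forall>x>0. (g has_real_derivative g' x) (at x)"
      by blast
    then have "\<forall>x>0. ((\<lambda>x. f x * g x) has_real_derivative f' x * g x + g' x * f x) (at x)"
      by (auto intro: DERIV_mult)
    moreover have "(\<lambda>x. f' x * g x + g' x * f x) \<in> ring_span G"
      using * mult.hyps by (intro ring_span.add ring_span.mult)
    ultimately show ?case by (intro bexI)
  qed
qed

text \<open>
  The functions of interest are meaningful on the positive half-line only; this half-line is open,
  so identities on it may be differentiated.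
\<close>

lemma has_real_derivative_cong_pos:
  assumes "(f has_real_derivative d) (at x)" "0 < x" "\<And>y. 0 < y \<Longrightarrow> f y = g y"
  shows "(g has_real_derivative d) (at x)"
  using has_field_derivative_transform_within_open[OF assms(1), of "{0<..}" g] assms(2,3) by auto

text \<open>
  This is the smoothness statement that is used below. Every iterated derivative of \<open>f\<close> agrees on
  the positive half-line with a member of \<open>A\<close>, and members of \<open>A\<close> are differentiable there. The
  point is that \<^const>\<open>deriv\<close> is an arbitrary value wherever a function is not differentiable,
  so that nothing can be said about iterated derivatives before this is known.
\<close>

lemma has_real_derivative_higher_deriv:
  assumes A: "closed_under_deriv A" and f: "f \<in> A" and x: "0 < x"
  shows "((deriv ^^ k) f has_real_derivative (deriv ^^ Suc k) f x) (at x)"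
proof -
  have "\<exists>g\<in>A. \<forall>x>0. (deriv ^^ k) f x = g x" for k
  proof (induction k)
    case 0
    show ?case using f by auto
  next
    case (Suc k)
    then obtain g where g: "g \<in> A" "\<forall>x>0. (deriv ^^ k) f x = g x" by blast
    obtain g' where g': "g' \<in> A" "\<forall>x>0. (g has_real_derivative g' x) (at x)"
      using A g(1) by (auto simp: closed_under_deriv_def)
    have "(deriv ^^ Suc k) f y = g' y" if "0 < y" for y
      using has_real_derivative_cong_pos[of g "g' y" y "(deriv ^^ k) f"] g(2) g'(2) that
      by (simp add: DERIV_imp_deriv)
    with g'(1) show ?case by blast
  qed
  then obtain g where g: "g \<in> A" "\<forall>x>0. (deriv ^^ k) f x = g x" by blast
  obtain g' where g': "g' \<in> A" "\<forall>x>0. (g has_real_derivative g' x) (at x)"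
    using A g(1) by (auto simp: closed_under_deriv_def)
  have "((deriv ^^ k) f has_real_derivative g' x) (at x)"
    using has_real_derivative_cong_pos[of g "g' x" x "(deriv ^^ k) f"] g(2) g'(2) x by simp
  then show ?thesis by (simp add: DERIV_imp_deriv)
qed

text \<open>
  Iterated derivatives are computed by guessing the whole sequence of them at once.
\<close>

lemma higher_deriv_eq_tower:
  assumes "\<And>k x. 0 < x \<Longrightarrow> (F k has_real_derivative F (Suc k) x) (at x)"
    and "\<And>x. 0 < x \<Longrightarrow> f x = F 0 x" and "0 < x"
  shows "(deriv ^^ n) f x = F n x"
  using \<open>0 < x\<close>
proof (induction n arbitrary: x)
  case 0
  then show ?case using assms(2) by simp
next
  case (Suc n)
  then have "((deriv ^^ n) f has_real_derivative F (Suc n) x) (at x)"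
    by (intro has_real_derivative_cong_pos[OF assms(1)]) simp_all
  then show ?case by (simp add: DERIV_imp_deriv)
qed

text \<open>
  The induction step of the general Leibniz rule, for two sequences of successive derivatives: it
  is Pascal's rule for the coefficients.
\<close>

lemma Leibniz_tower:
  fixes F G :: "nat \<Rightarrow> real \<Rightarrow> real"
  assumes "\<And>k. (F k has_real_derivative F (Suc k) x) (at x)"
    and "\<And>k. (G k has_real_derivative G (Suc k) x) (at x)"
  shows "((\<lambda>x. \<Sum>k=0..n. real (n choose k) * F k x * G (n - k) x) has_real_derivative
           (\<Sum>k=0..Suc n. real (Suc n choose k) * F k x * G (Suc n - k) x)) (at x)"
proof -
  have "((\<lambda>x. \<Sum>k=0..n. real (n choose k) * F k x * G (n - k) x) has_real_derivative
      (\<Sum>k=0..n. real (n choose k) * F (Suc k) x * G (n - k) x +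
                 real (n choose k) * F k x * G (Suc (n - k)) x)) (at x)"
    by (auto intro!: derivative_eq_intros assms sum.cong simp: algebra_simps)
  also have "(\<Sum>k=0..n. real (n choose k) * F (Suc k) x * G (n - k) x +
                 real (n choose k) * F k x * G (Suc (n - k)) x) =
     (\<Sum>k=0..n. real (n choose k) * F (Suc k) x * G (n - k) x) +
     (\<Sum>k=0..n. real (n choose k) * F k x * G (Suc n - k) x)"
    by (simp add: sum.distrib Suc_diff_le)
  also have "(\<Sum>k=0..n. real (n choose k) * F k x * G (Suc n - k) x) =
     (\<Sum>k=0..Suc n. real (n choose k) * F k x * G (Suc n - k) x)"
    by simp
  also have "\<dots> = F 0 x * G (Suc n) x +
     (\<Sum>k=0..n. real (n choose Suc k) * F (Suc k) x * G (n - k) x)"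
    by (subst sum.atLeast0_atMost_Suc_shift) simp
  also have "(\<Sum>k=0..n. real (n choose k) * F (Suc k) x * G (n - k) x) + \<dots> =
     (\<Sum>k=0..Suc n. real (Suc n choose k) * F k x * G (Suc n - k) x)"
    by (subst sum.atLeast0_atMost_Suc_shift) (simp add: sum.distrib algebra_simps)
  finally show ?thesis .
qed

section \<open>The derivatives of $e^{-c/x}$\<close>

text \<open>
  The factor \<open>c powi (- int k)\<close> comes from the scaling of the variable by \<open>1/c\<close> in
  $e^{-c/x} = g(x/c)$ with $g(x) = e^{-1/x}$. The right-hand side gives the recursion
  $p_{k+1}(s) = s^2 (p_k(s) - p_k'(s))$.
\<close>

lemma exp_inv_poly_Suc_derivative:
  fixes q :: "real poly"
  assumes "x > 0" "c > 0"
  shows "((\<lambda>x. c powi (- int k) * poly q (c / x) * exp (- (c / x))) has_real_derivative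
     c powi (- int (Suc k)) * poly ([:0, 0, 1:] * (q - pderiv q)) (c / x) * exp (- (c / x))) (at x)"
proof -
  have "((\<lambda>x. C * poly q (c / x) * exp (- (c / x))) has_real_derivative
     C / c * poly ([:0, 0, 1:] * (q - pderiv q)) (c / x) * exp (- (c / x))) (at x)" for C
    using assms
    by (auto intro!: derivative_eq_intros simp: field_simps power2_eq_square)
  moreover have "c powi (- int k) / c = c powi (- int (Suc k))"
    using assms by (simp only: power_int_minus power_int_of_nat power_Suc2) (simp add: field_simps)
  ultimately show ?thesis by metis
qed

primrec exp_inv_rec_poly :: "nat \<Rightarrow> real poly" where
  "exp_inv_rec_poly 0 = 1"
| "exp_inv_rec_poly (Suc k) = [:0, 0, 1:] * (exp_inv_rec_poly k - pderiv (exp_inv_rec_poly k))"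

text \<open>
  Uniqueness in the definition of \<^const>\<open>exp_inv_poly\<close> holds because a polynomial is determined
  by its values at the infinitely many points \<open>1/x\<close> with \<open>x > 0\<close>.
\<close>

lemma exp_inv_poly_eq: "exp_inv_poly k = exp_inv_rec_poly k"
  unfolding exp_inv_poly_def
proof (rule the_equality)
  have *: "(deriv ^^ k) (\<lambda>y. exp (- (1 / y))) x = poly (exp_inv_rec_poly k) (1 / x) * exp (- (1 / x))"
    if "0 < x" for x :: real
    using that
    by (intro higher_deriv_eq_tower[where F = "\<lambda>k x. poly (exp_inv_rec_poly k) (1 / x) * exp (- (1 / x))"])
       (use exp_inv_poly_Suc_derivative[of _ 1] in simp_all)
  then show "\<forall>x>0. (deriv ^^ k) (\<lambda>y. exp (- (1 / y))) x = poly (exp_inv_rec_poly k) (1 / x) * exp (- (1 / x))"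
    by blast
  fix r :: "real poly"
  assume r: "\<forall>x>0. (deriv ^^ k) (\<lambda>y. exp (- (1 / y))) x = poly r (1 / x) * exp (- (1 / x))"
  have "poly r s = poly (exp_inv_rec_poly k) s" if "0 < s" for s
    using r[rule_format, of "1 / s"] *[of "1 / s"] that by simp
  then have "{0<..} \<subseteq> {s. poly (r - exp_inv_rec_poly k) s = 0}" by auto
  moreover have "infinite {0::real<..}" by (rule infinite_Ioi)
  ultimately have "infinite {s. poly (r - exp_inv_rec_poly k) s = 0}" using finite_subset by blast
  then show "r = exp_inv_rec_poly k" using poly_roots_finite[of "r - exp_inv_rec_poly k"] by auto
qed

section \<open>A family of series stable under partial differentiation\<close>

text \<open>
  For \<open>j = 1\<close> this is $y^{-x}\int_0^y e^{-t}t^{x-1}\,dt$, expanded by integrating the exponential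
  series term by term. The higher exponents \<open>j\<close> occur when one differentiates in \<open>x\<close>.
\<close>

definition gamma_series :: "nat \<Rightarrow> real \<Rightarrow> real \<Rightarrow> real" where
  "gamma_series j x y = (\<Sum>n. (- y) ^ n / (fact n * (x + real n) ^ j))"

text \<open>
  One summable majorant for \<open>x\<close> away from \<open>0\<close> and bounded \<open>y\<close> gives convergence, joint
  continuity and differentiability in \<open>x\<close>.
\<close>

lemma gamma_series_term_le:
  assumes "0 < a" "a \<le> x" "\<bar>y\<bar> \<le> R"
  shows "norm ((- y) ^ n / (fact n * (x + real n) ^ j)) \<le> (1 / a ^ j) * (R ^ n / fact n)"
proof -
  have "a ^ j \<le> (x + real n) ^ j" using assms by (intro power_mono) auto
  moreover have "\<bar>y\<bar> ^ n \<le> R ^ n" using assms by (intro power_mono) auto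
  moreover have "0 < a ^ j" "0 \<le> R ^ n" "0 \<le> (x + real n) ^ j" using assms by auto
  ultimately have "\<bar>y\<bar> ^ n / (x + real n) ^ j \<le> R ^ n / a ^ j" by (intro frac_le) auto
  from divide_right_mono[OF this, of "fact n"] show ?thesis
    using assms by (simp add: abs_mult power_abs field_simps)
qed

lemma summable_majorant: "summable (\<lambda>n. C * (R ^ n / fact n :: real))"
  using summable_exp[of R] by (intro summable_mult) (simp add: field_simps)

lemma summable_gamma_series:
  "0 < x \<Longrightarrow> summable (\<lambda>n. (- y) ^ n / (fact n * (x + real n) ^ j))"
  by (rule summable_comparison_test'[OF summable_majorant gamma_series_term_le[of x x y "\<bar>y\<bar>"]]) auto

lemma isCont_gamma_series:
  assumes "0 < x"
  shows "isCont (\<lambda>(x, y). gamma_series j x y) (x, y)"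
proof -
  let ?S = "{x/2<..} \<times> {-\<bar>y\<bar>-1<..<\<bar>y\<bar>+1}"
  have "uniform_limit ?S (\<lambda>N z. \<Sum>n<N. (- snd z) ^ n / (fact n * (fst z + real n) ^ j))
          (\<lambda>z. \<Sum>n. (- snd z) ^ n / (fact n * (fst z + real n) ^ j)) sequentially"
    by (rule Weierstrass_m_test[OF gamma_series_term_le[of "x/2" _ _ "\<bar>y\<bar>+1"] summable_majorant])
       (use assms in auto)
  then have "continuous_on ?S (\<lambda>z. \<Sum>n. (- snd z) ^ n / (fact n * (fst z + real n) ^ j))"
    by (rule uniform_limit_theorem[rotated])
       (use assms in \<open>auto intro!: always_eventually continuous_intros\<close>)
  then have "continuous_on ?S (\<lambda>(x, y). gamma_series j x y)"
    by (simp add: gamma_series_def case_prod_unfold)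
  moreover have "open ?S" by (intro open_Times open_greaterThan open_greaterThanLessThan)
  moreover have "(x, y) \<in> ?S" using assms by auto
  ultimately show ?thesis using continuous_on_eq_continuous_at by blast
qed

lemma gamma_series_derivative_fst:
  assumes "0 < x"
  shows "((\<lambda>x. gamma_series j x y) has_real_derivative - real j * gamma_series (Suc j) x y) (at x)"
proof -
  let ?f = "\<lambda>n x. (- y) ^ n / (fact n * (x + real n) ^ j)"
  let ?f' = "\<lambda>n x. - real j * ((- y) ^ n / (fact n * (x + real n) ^ Suc j))"
  have d: "(?f n has_real_derivative ?f' n t) (at t within {x/2<..})" if "t \<in> {x/2<..}" for n t
  proof -
    have "t + real n \<noteq> 0" using that assms by auto
    then have "((\<lambda>t. inverse (t + real n) ^ j) has_real_derivative
        - real j * inverse (t + real n) ^ Suc j) (at t within {x/2<..})"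
    proof (cases j)
      case (Suc m)
      have "((\<lambda>t. inverse (t + real n)) has_real_derivative - (inverse (t + real n))\<^sup>2)
          (at t within {x/2<..})"
        using \<open>t + real n \<noteq> 0\<close> by (auto intro!: derivative_eq_intros simp: power2_eq_square)
      from DERIV_power_Suc[OF this, of m] show ?thesis
        by (simp add: Suc power2_eq_square algebra_simps)
    qed simp
    from DERIV_cmult[OF this, of "(- y) ^ n / fact n"]
    have "((\<lambda>t. (- y) ^ n / fact n * inverse (t + real n) ^ j) has_real_derivative
        (- y) ^ n / fact n * (- real j * inverse (t + real n) ^ Suc j)) (at t within {x/2<..})" .
    moreover have "(- y) ^ n / fact n * inverse (s + real n) ^ i = (- y) ^ n / (fact n * (s + real n) ^ i)" for s i
      by (simp add: divide_inverse power_inverse)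
    ultimately show ?thesis
      by (simp only: mult.left_commute[of "(- y) ^ n / fact n" "- real j"])
  qed
  have "uniform_limit {x/2<..} (\<lambda>N t. \<Sum>n<N. ?f' n t) (\<lambda>t. \<Sum>n. ?f' n t) sequentially"
  proof (rule Weierstrass_m_test[OF _ summable_mult[OF summable_majorant]])
    fix n t assume "t \<in> {x/2<..}"
    then have "norm ((- y) ^ n / (fact n * (t + real n) ^ Suc j))
        \<le> (1 / (x/2) ^ Suc j) * (\<bar>y\<bar> ^ n / fact n)"
      using assms by (intro gamma_series_term_le) auto
    from mult_left_mono[OF this, of "real j"]
    show "norm (?f' n t) \<le> real j * ((1 / (x/2) ^ Suc j) * (\<bar>y\<bar> ^ n / fact n))"
      by (simp only: norm_mult) simp
  qed
  then have u: "uniformly_convergent_on {x/2<..} (\<lambda>N t. \<Sum>n<N. ?f' n t)"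
    by (auto simp: uniformly_convergent_on_def)
  have "((\<lambda>x. \<Sum>n. ?f n x) has_real_derivative (\<Sum>n. ?f' n x)) (at x)"
    by (rule has_field_derivative_series'(2)[OF _ d u])
       (use assms summable_gamma_series[of x] in \<open>auto simp: interior_open\<close>)
  then show ?thesis
    using summable_gamma_series[OF assms, of y "Suc j"]
    by (simp only: gamma_series_def suminf_mult)
qed

text \<open>
  Differentiating $(-y)^n/n!$ shifts the summation index by one, which amounts to a shift of \<open>x\<close>.
\<close>

lemma gamma_series_derivative_snd:
  assumes "0 < x"
  shows "(gamma_series j x has_real_derivative - gamma_series j (x + 1) y) (at y)"
proof -
  let ?c = "\<lambda>n. (- 1) ^ n / (fact n * (x + real n) ^ j)"
  have t: "?c n * y ^ n = (- y) ^ n / (fact n * (x + real n) ^ j)" for n y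
    by (simp flip: power_mult_distrib)
  have "((\<lambda>y. \<Sum>n. ?c n * y ^ n) has_real_derivative (\<Sum>n. diffs ?c n * y ^ n)) (at y)"
    by (rule termdiffs_strong_converges_everywhere)
       (use assms summable_gamma_series in \<open>simp only: t\<close>)
  also have "(\<lambda>y. \<Sum>n. ?c n * y ^ n) = gamma_series j x"
    by (simp only: gamma_series_def[abs_def] t)
  also have "(\<lambda>n. diffs ?c n * y ^ n) =
      (\<lambda>n. - ((- y) ^ n / (fact n * (x + 1 + real n) ^ j)))"
  proof
    fix n
    have "diffs ?c n = - ((- 1) ^ n / (fact n * (x + 1 + real n) ^ j))"
      by (simp add: diffs_def ac_simps)
    then show "diffs ?c n * y ^ n = - ((- y) ^ n / (fact n * (x + 1 + real n) ^ j))"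
      by (simp flip: power_mult_distrib)
  qed
  also have "suminf \<dots> = - gamma_series j (x + 1) y"
    unfolding gamma_series_def using assms by (intro suminf_minus summable_gamma_series) simp
  finally show ?thesis .
qed

text \<open>
  Termwise this is $x/(x+n) + n/(x+n) = 1$; for the incomplete gamma function it is integration by
  parts.
\<close>

lemma gamma_series_recurrence:
  assumes "0 < x"
  shows "x * gamma_series 1 x y - y * gamma_series 1 (x + 1) y = exp (- y)"
proof -
  let ?f = "\<lambda>n. (- y) ^ n / (fact n * (x + real n))"
  have s: "summable ?f" using summable_gamma_series[OF assms, of y 1] by simp
  have s1: "summable (\<lambda>n. (- y) ^ n / (fact n * (x + 1 + real n)))"
    using summable_gamma_series[of "x + 1" y 1] assms by simp
  have "(\<lambda>n. (- y) * ((- y) ^ n / (fact n * (x + 1 + real n)))) sums (- y * gamma_series 1 (x + 1) y)"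
    using s1 by (intro sums_mult) (simp add: gamma_series_def summable_sums)
  also have "(\<lambda>n. (- y) * ((- y) ^ n / (fact n * (x + 1 + real n)))) =
      (\<lambda>n. real (Suc n) * ?f (Suc n))"
    by (auto simp: fun_eq_iff ac_simps simp del: of_nat_Suc)
  finally have "(\<lambda>n. real n * ?f n) sums (- y * gamma_series 1 (x + 1) y)"
    by (subst (asm) sums_Suc_iff) simp
  moreover have "(\<lambda>n. x * ?f n) sums (x * gamma_series 1 x y)"
    using s by (intro sums_mult) (simp add: gamma_series_def summable_sums)
  ultimately have "(\<lambda>n. x * ?f n + real n * ?f n) sums
      (x * gamma_series 1 x y + - y * gamma_series 1 (x + 1) y)"
    by (rule sums_add[rotated])
  moreover have "x * ?f n + real n * ?f n = (- y) ^ n /\<^sub>R fact n" for n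
  proof -
    have "x + real n \<noteq> 0" using assms by linarith
    then show ?thesis by (simp add: divide_simps) (simp add: algebra_simps)
  qed
  ultimately have "(\<lambda>n. (- y) ^ n /\<^sub>R fact n) sums
      (x * gamma_series 1 x y + - y * gamma_series 1 (x + 1) y)"
    by simp
  from sums_unique2[OF this exp_converges] show ?thesis by simp
qed

section \<open>The lower incomplete gamma function\<close>

definition lower_gamma :: "real \<Rightarrow> real \<Rightarrow> real" where
  "lower_gamma x y = y powr x * gamma_series 1 x y"

text \<open>
  The recurrence turns the derivative of the series into the integrand of the gamma integral. Hence
  \<^const>\<open>lower_gamma\<close> is the incomplete gamma integral, by the fundamental theorem of calculus,
  and no integral has to be differentiated with respect to the parameter \<open>x\<close>.
\<close>

lemma lower_gamma_derivative_snd: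
  assumes "0 < x" "0 < y"
  shows "(lower_gamma x has_real_derivative exp (- y) * y powr (x - 1)) (at y)"
proof -
  have "y powr x = y * y powr (x - 1)"
    using assms by (simp add: powr_diff)
  then have "x * y powr (x - 1) * gamma_series 1 x y - y powr x * gamma_series 1 (x + 1) y
      = (x * gamma_series 1 x y - y * gamma_series 1 (x + 1) y) * y powr (x - 1)"
    by (simp add: algebra_simps)
  also have "\<dots> = exp (- y) * y powr (x - 1)"
    using gamma_series_recurrence[OF assms(1)] by simp
  finally show ?thesis
    using assms unfolding lower_gamma_def[abs_def]
    by (auto intro!: derivative_eq_intros gamma_series_derivative_snd simp: algebra_simps)
qed

lemma lower_gamma_derivative_fst:
  assumes "0 < x" "0 < y"
  shows "((\<lambda>x. lower_gamma x y) has_real_derivative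
           y powr x * (ln y * gamma_series 1 x y - gamma_series 2 x y)) (at x)"
proof -
  have "((\<lambda>x. gamma_series 1 x y) has_real_derivative - gamma_series 2 x y) (at x)"
    using gamma_series_derivative_fst[OF assms(1), of 1 y] by (simp add: numeral_2_eq_2)
  then show ?thesis
    using assms unfolding lower_gamma_def
    by (auto intro!: derivative_eq_intros simp: algebra_simps)
qed

lemma continuous_on_lower_gamma:
  assumes "0 < x"
  shows "continuous_on {0..} (lower_gamma x)"
proof -
  have "continuous_on {0..} (gamma_series 1 x)"
    using gamma_series_derivative_snd[OF assms]
    by (intro continuous_at_imp_continuous_on ballI) (rule DERIV_isCont)
  then show ?thesis
    unfolding lower_gamma_def[abs_def] using assms
    by (intro continuous_on_mult continuous_on_powr') (auto intro: continuous_intros)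
qed

lemma has_integral_lower_gamma:
  assumes "0 < x" "0 \<le> y"
  shows "((\<lambda>t. exp (- t) * t powr (x - 1)) has_integral lower_gamma x y) {0..y}"
proof -
  have "((\<lambda>t. exp (- t) * t powr (x - 1)) has_integral lower_gamma x y - lower_gamma x 0) {0..y}"
    using assms
    by (intro fundamental_theorem_of_calculus_interior
          continuous_on_subset[OF continuous_on_lower_gamma])
       (auto simp flip: has_real_derivative_iff_has_vector_derivative
             intro: lower_gamma_derivative_snd)
  then show ?thesis by (simp add: lower_gamma_def)
qed

lemma lower_gamma_strict_mono:
  assumes "0 < x" "0 < a" "a < b"
  shows "lower_gamma x a < lower_gamma x b"
proof (rule DERIV_pos_imp_increasing[OF \<open>a < b\<close>])
  fix y assume "a \<le> y" "y \<le> b"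
  with assms show "\<exists>d. (lower_gamma x has_real_derivative d) (at y) \<and> 0 < d"
    by (intro exI[of _ "exp (- y) * y powr (x - 1)"]) (simp add: lower_gamma_derivative_snd)
qed

lemma lower_gamma_less_iff:
  assumes "0 < x" "0 < a" "0 < b"
  shows "lower_gamma x a < lower_gamma x b \<longleftrightarrow> a < b"
  using assms lower_gamma_strict_mono[of x a b] lower_gamma_strict_mono[of x b a]
  by (cases a b rule: linorder_cases) auto

text \<open>
  The incomplete integrals tend to the complete one. This makes the quantile exist for every
  \<open>p < 1\<close>.
\<close>

lemma lower_gamma_exceeds:
  assumes "0 < x" "c < Gamma x"
  obtains y where "0 < y" "c < lower_gamma x y"
proof -
  let ?f = "\<lambda>t. exp (- t) * t powr (x - 1)"
  have "(?f has_integral Gamma x) {0..}"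
    using Gamma_integral_real[OF assms(1)] by (simp add: exp_minus divide_inverse mult.commute)
  moreover have "{0::real..} \<noteq> cbox a b" for a b
  proof -
    have "max 0 (b + 1) \<in> {0..}" "max 0 (b + 1) \<notin> cbox a b" by auto
    then show ?thesis by blast
  qed
  ultimately obtain B where B: "B > 0" "\<And>a b. ball 0 B \<subseteq> cbox a b \<Longrightarrow>
      \<exists>z. ((\<lambda>t. if t \<in> {0..} then ?f t else 0) has_integral z) (cbox a b) \<and>
          norm (z - Gamma x) < Gamma x - c"
    using has_integral_altD[of ?f "Gamma x" "{0..}" "Gamma x - c"] assms(2) by auto
  have "ball 0 B \<subseteq> cbox (- B) B" by (auto simp: dist_real_def)
  then obtain z where z: "((\<lambda>t. if t \<in> {0..} then ?f t else 0) has_integral z) (cbox (- B) B)"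
      "norm (z - Gamma x) < Gamma x - c"
    using B(2) by blast
  (* The gauge integral over the half-line is approximated over cbox (- B) B, where the
     restricted integrand vanishes left of 0. *)
  have "((\<lambda>t. if t \<in> {0..B} then ?f t else 0) has_integral lower_gamma x B) (cbox (- B) B)"
    using has_integral_restrict_closed_subinterval[of ?f "lower_gamma x B" 0 B "- B" B]
      has_integral_lower_gamma[of x B] assms(1) B(1) by simp
  then have "((\<lambda>t. if t \<in> {0..} then ?f t else 0) has_integral lower_gamma x B) (cbox (- B) B)"
    by (rule has_integral_eq[rotated]) auto
  then have "z = lower_gamma x B" using z(1) has_integral_unique by blast
  then show ?thesis using that[OF B(1)] z(2) by (auto simp: abs_if split: if_splits)
qed

section \<open>Existence and continuity of the quantile\<close>

text \<open>
  Existence is the intermediate value theorem between \<open>0\<close> and a point where the incomplete gamma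
  function exceeds \<open>p * Gamma x\<close>, uniqueness is strict monotonicity.
\<close>

lemma gamma_quantile_solution:
  assumes "0 < p" "p < 1" "0 < x"
  shows "0 < gamma_quantile p x" and "lower_gamma x (gamma_quantile p x) = p * Gamma x"
proof -
  have pG: "0 < p * Gamma x" "p * Gamma x < Gamma x"
    using assms Gamma_real_pos[of x] by auto
  obtain Y where Y: "0 < Y" "p * Gamma x < lower_gamma x Y"
    using lower_gamma_exceeds[OF assms(3) pG(2)] .
  have "\<exists>y\<ge>0. y \<le> Y \<and> lower_gamma x y = p * Gamma x"
    using Y pG assms
    by (intro IVT' continuous_on_subset[OF continuous_on_lower_gamma]) (auto simp: lower_gamma_def)
  then obtain y where y: "0 \<le> y" "lower_gamma x y = p * Gamma x" by blast
  then have "0 < y" using pG by (cases "y = 0") (auto simp: lower_gamma_def)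
  have int: "integral {0..y} (\<lambda>t. exp (- t) * t powr (x - 1)) = lower_gamma x y" if "0 < y" for y
    using has_integral_lower_gamma[of x y] assms that by (simp add: integral_unique)
  have "\<exists>!y. 0 < y \<and> integral {0..y} (\<lambda>t. exp (- t) * t powr (x - 1)) = p * Gamma x"
  proof (rule ex1I[of _ y])
    show "0 < y \<and> integral {0..y} (\<lambda>t. exp (- t) * t powr (x - 1)) = p * Gamma x"
      using \<open>0 < y\<close> y(2) int by simp
    fix z assume z: "0 < z \<and> integral {0..z} (\<lambda>t. exp (- t) * t powr (x - 1)) = p * Gamma x"
    then show "z = y"
      using lower_gamma_less_iff[of x y z] lower_gamma_less_iff[of x z y] assms \<open>0 < y\<close> y(2) int[of z]
      by auto
  qed
  from theI'[OF this]
  have "0 < gamma_quantile p x \<and>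
      integral {0..gamma_quantile p x} (\<lambda>t. exp (- t) * t powr (x - 1)) = p * Gamma x"
    by (simp add: gamma_quantile_def)
  then show "0 < gamma_quantile p x" "lower_gamma x (gamma_quantile p x) = p * Gamma x"
    using int by auto
qed

text \<open>
  For fixed \<open>a > 0\<close>, the sign of \<open>lower_gamma t a - p * Gamma t\<close> tells on which side of \<open>a\<close>
  the quantile at \<open>t\<close> lies, and this expression is continuous in \<open>t\<close>. So a strict inequality
  between \<open>a\<close> and the quantile at \<open>x\<close> persists near \<open>x\<close>.
\<close>

lemma isCont_gamma_quantile:
  assumes "0 < p" "p < 1" "0 < x"
  shows "isCont (gamma_quantile p) x"
  unfolding isCont_def
proof (rule order_tendstoI)
  let ?m = "gamma_quantile p"
  note q = gamma_quantile_solution[OF assms(1,2)]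
  have pos: "\<forall>\<^sub>F t in at x. 0 < t"
    using assms(3) by (intro order_tendstoD(1)[OF tendsto_ident_at]) 
  have lim: "((\<lambda>t. lower_gamma t y - p * Gamma t) \<longlongrightarrow> lower_gamma x y - p * Gamma x) (at x)"
    if "0 < y" for y
  proof -
    have "isCont (\<lambda>t. lower_gamma t y) x"
      using lower_gamma_derivative_fst[OF assms(3) that] by (rule DERIV_isCont)
    moreover have "isCont Gamma x"
      using assms(3) by (intro isCont_Gamma) (auto elim: nonpos_Ints_cases)
    ultimately show ?thesis unfolding isCont_def by (intro tendsto_diff tendsto_mult tendsto_const)
  qed
  show "\<forall>\<^sub>F t in at x. a < ?m t" if "a < ?m x" for a
  proof (cases "0 < a")
    case True
    then have "lower_gamma x a - p * Gamma x < 0"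
      using lower_gamma_less_iff[of x a "?m x"] q[of x] assms that by auto
    from order_tendstoD(2)[OF lim[OF True] this] pos show ?thesis
    proof eventually_elim
      case (elim t)
      then show ?case using lower_gamma_less_iff[of t a "?m t"] q[of t] True by auto
    qed
  next
    case False
    from pos show ?thesis by eventually_elim (use q(1) False in force)
  qed
  show "\<forall>\<^sub>F t in at x. ?m t < a" if "?m x < a" for a
  proof -
    have "0 < a" using q(1)[OF assms(3)] that by simp
    then have "0 < lower_gamma x a - p * Gamma x"
      using lower_gamma_less_iff[of x "?m x" a] q[of x] assms that by auto
    from order_tendstoD(1)[OF lim[OF \<open>0 < a\<close>] this] pos show ?thesis
    proof eventually_elim
      case (elim t)
      then show ?case using lower_gamma_less_iff[of t "?m t" a] q[of t] \<open>0 < a\<close> by auto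
    qed
  qed
qed

section \<open>Differentiation along a graph and implicit differentiation\<close>

text \<open>
  The mean value theorem in the second variable, with intermediate points that converge to
  \<open>m a\<close>. Both the chain rule along a graph and implicit differentiation follow from this one
  formula by dividing by \<open>x - a\<close>.
\<close>

lemma increment_snd_along_graph:
  fixes F Fy :: "real \<Rightarrow> real \<Rightarrow> real" and m :: "real \<Rightarrow> real"
  assumes deriv: "\<And>x y. 0 < x \<Longrightarrow> 0 < y \<Longrightarrow> (F x has_real_derivative Fy x y) (at y)"
    and cont: "isCont (\<lambda>(x, y). Fy x y) (a, m a)"
    and m: "isCont m a" "\<And>x. 0 < x \<Longrightarrow> 0 < m x" and a: "0 < a"
  obtains s where "(s \<longlongrightarrow> Fy a (m a)) (at a)"
    "\<And>x. 0 < x \<Longrightarrow> F x (m x) - F x (m a) = s x * (m x - m a)"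
proof -
  have "\<exists>z. \<bar>z - m a\<bar> \<le> \<bar>m x - m a\<bar> \<and>
      (0 < x \<longrightarrow> F x (m x) - F x (m a) = Fy x z * (m x - m a))" for x
  proof (cases "0 < x \<and> m x \<noteq> m a")
    case False
    then show ?thesis by (intro exI[of _ "m a"]) auto
  next
    case True
    have d: "DERIV (F x) y :> Fy x y" if "min (m x) (m a) \<le> y" for y
      using deriv[of x y] m(2)[of x] m(2)[of a] a True that by (auto simp: min_le_iff_disj)
    show ?thesis
    proof (cases "m x < m a")
      case True
      then obtain z where "m x < z" "z < m a" "F x (m a) - F x (m x) = (m a - m x) * Fy x z"
        using MVT2[of "m x" "m a" "F x" "Fy x"] d by auto
      then show ?thesis by (intro exI[of _ z]) (auto simp: algebra_simps)
    next
      case False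
      with \<open>0 < x \<and> m x \<noteq> m a\<close> have "m a < m x" by auto
      then obtain z where "m a < z" "z < m x" "F x (m x) - F x (m a) = (m x - m a) * Fy x z"
        using MVT2[of "m a" "m x" "F x" "Fy x"] d by auto
      then show ?thesis by (intro exI[of _ z]) (auto simp: algebra_simps)
    qed
  qed
  then obtain z where z: "\<And>x. \<bar>z x - m a\<bar> \<le> \<bar>m x - m a\<bar>"
    "\<And>x. 0 < x \<Longrightarrow> F x (m x) - F x (m a) = Fy x (z x) * (m x - m a)"
    by metis
  have "((\<lambda>x. m x - m a) \<longlongrightarrow> 0) (at a)"
    using m(1) by (simp add: isCont_def LIM_zero)
  then have "((\<lambda>x. z x - m a) \<longlongrightarrow> 0) (at a)"
    by (rule Lim_null_comparison[rotated, OF tendsto_rabs_zero]) (simp add: z(1))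
  then have "(z \<longlongrightarrow> m a) (at a)" by (simp add: LIM_zero_iff)
  then have "((\<lambda>x. (x, z x)) \<longlongrightarrow> (a, m a)) (at a)" by (intro tendsto_intros)
  from isCont_tendsto_compose[OF cont this] have "((\<lambda>x. Fy x (z x)) \<longlongrightarrow> Fy a (m a)) (at a)" by simp
  then show ?thesis using z(2) by (rule that)
qed

lemma has_real_derivative_along_graph:
  fixes F Fy :: "real \<Rightarrow> real \<Rightarrow> real" and m :: "real \<Rightarrow> real"
  assumes Fx: "((\<lambda>x. F x (m a)) has_real_derivative Fx) (at a)"
    and Fy: "\<And>x y. 0 < x \<Longrightarrow> 0 < y \<Longrightarrow> (F x has_real_derivative Fy x y) (at y)"
    and cont: "isCont (\<lambda>(x, y). Fy x y) (a, m a)"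
    and m: "(m has_real_derivative m') (at a)" "\<And>x. 0 < x \<Longrightarrow> 0 < m x" and a: "0 < a"
  shows "((\<lambda>x. F x (m x)) has_real_derivative Fx + Fy a (m a) * m') (at a)"
proof -
  obtain s where s: "(s \<longlongrightarrow> Fy a (m a)) (at a)"
    "\<And>x. 0 < x \<Longrightarrow> F x (m x) - F x (m a) = s x * (m x - m a)"
    using increment_snd_along_graph[OF Fy cont DERIV_isCont[OF m(1)] m(2) a] by blast
  have "((\<lambda>x. (F x (m a) - F a (m a)) / (x - a) + s x * ((m x - m a) / (x - a)))
      \<longlongrightarrow> Fx + Fy a (m a) * m') (at a)"
    using Fx m(1) unfolding has_field_derivative_iff by (intro tendsto_intros s(1))
  moreover have "\<forall>\<^sub>F x in at a. 0 < x"
    using a by (intro order_tendstoD(1)[OF tendsto_ident_at])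
  then have "\<forall>\<^sub>F x in at a. (F x (m a) - F a (m a)) / (x - a) + s x * ((m x - m a) / (x - a))
      = (F x (m x) - F a (m a)) / (x - a)"
    by eventually_elim (simp add: s(2)[symmetric] flip: add_divide_distrib)
  ultimately show ?thesis
    unfolding has_field_derivative_iff by (rule Lim_transform_eventually)
qed

text \<open>
  Here \<open>m\<close> is known to be continuous. Writing $F(x,m(x)) - F(a,m(a)) = c(x) - c(a)$ as the
  sum of an increment in each variable, one solves for $m(x) - m(a)$.
\<close>

lemma has_real_derivative_implicit:
  fixes F Fy :: "real \<Rightarrow> real \<Rightarrow> real" and m c :: "real \<Rightarrow> real"
  assumes Fx: "((\<lambda>x. F x (m a)) has_real_derivative Fx) (at a)"
    and Fy: "\<And>x y. 0 < x \<Longrightarrow> 0 < y \<Longrightarrow> (F x has_real_derivative Fy x y) (at y)"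
    and cont: "isCont (\<lambda>(x, y). Fy x y) (a, m a)" and nz: "Fy a (m a) \<noteq> 0"
    and m: "isCont m a" "\<And>x. 0 < x \<Longrightarrow> 0 < m x" and a: "0 < a"
    and eq: "\<And>x. 0 < x \<Longrightarrow> F x (m x) = c x" and c: "(c has_real_derivative c') (at a)"
  shows "(m has_real_derivative (c' - Fx) / Fy a (m a)) (at a)"
proof -
  obtain s where s: "(s \<longlongrightarrow> Fy a (m a)) (at a)"
    "\<And>x. 0 < x \<Longrightarrow> F x (m x) - F x (m a) = s x * (m x - m a)"
    using increment_snd_along_graph[OF Fy cont m a] by blast
  have "((\<lambda>x. ((c x - c a) / (x - a) - (F x (m a) - F a (m a)) / (x - a)) / s x)
      \<longlongrightarrow> (c' - Fx) / Fy a (m a)) (at a)"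
    using Fx c unfolding has_field_derivative_iff by (intro tendsto_intros s(1) nz)
  moreover have "\<forall>\<^sub>F x in at a. ((c x - c a) / (x - a) - (F x (m a) - F a (m a)) / (x - a)) / s x
      = (m x - m a) / (x - a)"
    using order_tendstoD(1)[OF tendsto_ident_at a] tendsto_imp_eventually_ne[OF s(1) nz]
  proof eventually_elim
    case (elim x)
    have "(c x - c a) - (F x (m a) - F a (m a)) = s x * (m x - m a)"
      using eq[OF elim(1)] eq[OF a] s(2)[OF elim(1)] by simp
    then show ?case using elim(2) by (simp flip: diff_divide_distrib)
  qed
  ultimately show ?thesis
    unfolding has_field_derivative_iff by (rule Lim_transform_eventually)
qed

section \<open>The differential system of the quantile\<close>

text \<open>
  This is $m'/m$ for the quantile \<open>m\<close>. The summands \<open>real 0\<close> and the factor \<open>- 1\<close> make it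
  visibly a polynomial in the generators below.
\<close>

definition quantile_log_deriv :: "real \<Rightarrow> real \<Rightarrow> real" where
  "quantile_log_deriv p x = exp (gamma_quantile p x) *
     ((Digamma x + - 1 * ln (gamma_quantile p x)) * gamma_series 1 (x + real 0) (gamma_quantile p x)
        + gamma_series 2 (x + real 0) (gamma_quantile p x))"

text \<open>
  Implicit differentiation of \<open>lower_gamma x (m x) = p * Gamma x\<close>. Replacing \<open>p * Gamma x\<close> in
  the result by \<open>m x powr x * gamma_series 1 x (m x)\<close> cancels all real powers of \<open>m x\<close>, so that
  only the digamma function, the logarithm, the exponential and the series remain.
\<close>

lemma gamma_quantile_derivative:
  assumes "0 < p" "p < 1" "0 < x"
  shows "(gamma_quantile p has_real_derivative gamma_quantile p x * quantile_log_deriv p x) (at x)"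
proof -
  let ?m = "gamma_quantile p"
  let ?Fx = "?m x powr x * (ln (?m x) * gamma_series 1 x (?m x) - gamma_series 2 x (?m x))"
  note q = gamma_quantile_solution[OF assms(1,2)]
  have m: "0 < ?m x" using q(1) assms(3) .
  have "x \<notin> \<int>\<^sub>\<le>\<^sub>0" using assms(3) by (auto elim: nonpos_Ints_cases)
  then have c: "((\<lambda>x. p * Gamma x) has_real_derivative p * Gamma x * Digamma x) (at x)"
    by (auto intro!: derivative_eq_intros)
  have "isCont (\<lambda>(x, y). exp (- y) * y powr (x - 1)) (x, ?m x)"
    using m unfolding isCont_def case_prod_unfold by (auto intro!: tendsto_eq_intros)
  then have "(?m has_real_derivative
      (p * Gamma x * Digamma x - ?Fx) / (exp (- ?m x) * ?m x powr (x - 1))) (at x)"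
    using m by (intro has_real_derivative_implicit[where F = lower_gamma and
          Fy = "\<lambda>x y. exp (- y) * y powr (x - 1)" and c = "\<lambda>x. p * Gamma x"]
          lower_gamma_derivative_fst lower_gamma_derivative_snd isCont_gamma_quantile c q assms) auto
  also have "p * Gamma x = ?m x powr x * gamma_series 1 x (?m x)"
    using q(2)[OF assms(3)] by (simp add: lower_gamma_def)
  also have "?m x powr x = ?m x * ?m x powr (x - 1)"
    using m by (simp add: powr_diff)
  also have "(?m x * ?m x powr (x - 1) * gamma_series 1 x (?m x) * Digamma x -
        ?m x * ?m x powr (x - 1) * (ln (?m x) * gamma_series 1 x (?m x) - gamma_series 2 x (?m x)))
        / (exp (- ?m x) * ?m x powr (x - 1)) = ?m x * quantile_log_deriv p x"
    using m by (simp add: quantile_log_deriv_def exp_minus field_simps)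
  finally show ?thesis .
qed

text \<open>
  The companions of the quantile in a system of polynomial differential equations. The first two
  functions are there for the scaled quantile only.
\<close>

definition quantile_generators :: "real \<Rightarrow> (real \<Rightarrow> real) set" where
  "quantile_generators p =
     {inverse, \<lambda>x. exp (- (ln p / x)), gamma_quantile p,
      \<lambda>x. ln (gamma_quantile p x), \<lambda>x. exp (gamma_quantile p x)}
     \<union> range Polygamma
     \<union> range (\<lambda>(j, i). \<lambda>x. gamma_series j (x + real i) (gamma_quantile p x))"

text \<open>
  With \<open>W = m'/m\<close> the system reads $(\ln m)' = W$, $(e^m)' = e^m m W$,
  $\psi_n' = \psi_{n+1}$ and $H_{j,i}' = -j H_{j+1,i} - H_{j,i+1}\, m W$, where $\psi_n$ is
  the polygamma function and $H_{j,i}$ the series with exponent \<open>j\<close> and argument \<open>x + i\<close>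
  along the graph of \<open>m\<close>.
\<close>

lemma closed_under_deriv_quantile_generators:
  assumes p: "0 < p" "p < 1"
  shows "closed_under_deriv (ring_span (quantile_generators p))"
proof (rule closed_under_deriv_ring_span)
  let ?R = "ring_span (quantile_generators p)" and ?m = "gamma_quantile p"
  let ?H = "\<lambda>j i x. gamma_series j (x + real i) (gamma_quantile p x)"
  let ?W = "quantile_log_deriv p"
  have gens: "inverse \<in> ?R" "(\<lambda>x. exp (- (ln p / x))) \<in> ?R" "?m \<in> ?R" "(\<lambda>x. ln (?m x)) \<in> ?R"
      "(\<lambda>x. exp (?m x)) \<in> ?R" "Polygamma n \<in> ?R" "?H j i \<in> ?R" for n j i
    by (auto simp: quantile_generators_def intro!: ring_span.gen)
  have W: "?W \<in> ?R"
    unfolding quantile_log_deriv_def[abs_def] by (intro ring_span.intros(2-) gens)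
  note m_pos = gamma_quantile_solution(1)[OF p] and m_deriv = gamma_quantile_derivative[OF p]
  fix g assume "g \<in> quantile_generators p"
  then consider "g = inverse" | "g = (\<lambda>x. exp (- (ln p / x)))" | "g = ?m"
    | "g = (\<lambda>x. ln (?m x))" | "g = (\<lambda>x. exp (?m x))" | n where "g = Polygamma n"
    | j i where "g = ?H j i"
    by (auto simp: quantile_generators_def)
  then show "\<exists>g'\<in>?R. \<forall>x>0. (g has_real_derivative g' x) (at x)"
  proof cases
    case 1
    show ?thesis
    proof (intro bexI[of _ "\<lambda>x. - 1 * (inverse x * inverse x)"] allI impI)
      show "(g has_real_derivative - 1 * (inverse x * inverse x)) (at x)" if "0 < x" for x
        using that unfolding 1 by (auto intro!: derivative_eq_intros)
    qed (intro ring_span.intros(2-) gens)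
  next
    case 2
    show ?thesis
    proof (intro bexI[of _ "\<lambda>x. ln p * ((inverse x * inverse x) * exp (- (ln p / x)))"] allI impI)
      show "(g has_real_derivative ln p * ((inverse x * inverse x) * exp (- (ln p / x)))) (at x)"
        if "0 < x" for x
        using that unfolding 2 by (auto intro!: derivative_eq_intros simp: field_simps)
    qed (intro ring_span.intros(2-) gens)
  next
    case 3
    show ?thesis unfolding 3
      by (intro bexI[of _ "\<lambda>x. ?m x * ?W x"] allI impI m_deriv ring_span.intros(2-) gens W)
  next
    case 4
    show ?thesis
    proof (intro bexI[OF _ W] allI impI)
      show "(g has_real_derivative ?W x) (at x)" if "0 < x" for x
        using DERIV_chain2[OF DERIV_ln_divide[OF m_pos] m_deriv, OF that that] m_pos[OF that]
        unfolding 4 by simp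
    qed
  next
    case 5
    show ?thesis unfolding 5
      by (intro bexI[of _ "\<lambda>x. exp (?m x) * (?m x * ?W x)"] allI impI
          DERIV_chain2[OF DERIV_exp] m_deriv ring_span.intros(2-) gens W)
  next
    case 6
    show ?thesis
    proof (intro bexI[of _ "Polygamma (Suc n)"] allI impI gens)
      show "(g has_real_derivative Polygamma (Suc n) x) (at x)" if "0 < x" for x
        using that unfolding 6 by (intro has_field_derivative_Polygamma) (auto elim: nonpos_Ints_cases)
    qed
  next
    case 7
    show ?thesis
    proof (intro bexI[of _ "\<lambda>x. - real j * ?H (Suc j) i x + (- 1 * ?H j (Suc i) x) * (?m x * ?W x)"]
        allI impI)
      show "(g has_real_derivative
          - real j * ?H (Suc j) i x + (- 1 * ?H j (Suc i) x) * (?m x * ?W x)) (at x)" if x: "0 < x" for x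
        unfolding 7
      proof (rule has_real_derivative_along_graph[where F = "\<lambda>x. gamma_series j (x + real i)"
            and Fy = "\<lambda>x y. - 1 * gamma_series j (x + real (Suc i)) y"])
        show "((\<lambda>t. gamma_series j (t + real i) (?m x)) has_real_derivative - real j * ?H (Suc j) i x) (at x)"
          using x gamma_series_derivative_fst[of "x + real i" j "?m x"] by (simp add: DERIV_shift)
        show "(gamma_series j (t + real i) has_real_derivative
            - 1 * gamma_series j (t + real (Suc i)) y) (at y)" if "0 < t" for t y
          using that gamma_series_derivative_snd[of "t + real i" j y] by (simp add: ac_simps)
        have shift: "((\<lambda>z. (fst z + real (Suc i), snd z)) \<longlongrightarrow> (x + real (Suc i), ?m x)) (at (x, ?m x))"
          by (rule tendsto_eq_intros refl)+ simp_all
        have "isCont (\<lambda>(x, y). gamma_series j x y) (x + real (Suc i), ?m x)"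
          using x by (intro isCont_gamma_series) simp
        from tendsto_mult_left[OF isCont_tendsto_compose[OF this shift], of "- 1"]
        show "isCont (\<lambda>(x, y). - 1 * gamma_series j (x + real (Suc i)) y) (x, ?m x)"
          unfolding isCont_def case_prod_unfold by (simp only: fst_conv snd_conv)
      qed (use x m_deriv m_pos in auto)
    qed (intro ring_span.intros(2-) gens W)
  qed
qed

section \<open>The derivatives of the quantile\<close>

theorem proposition3p2:
  fixes p x :: real and n :: nat
  assumes "0 < p" and "p < 1" and "0 < x"
  shows "(deriv ^^ n) (gamma_quantile p) x =
    (\<Sum>k=0..n. real (n choose k) * (- ln p) powi (- int k) * poly (exp_inv_poly k) (- (ln p / x))
        * exp (ln p / x) * (deriv ^^ (n - k)) (scaled_quantile p) x)"
proof -
  let ?R = "ring_span (quantile_generators p)" and ?c = "- ln p"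
  (* Successive derivatives of the two factors of m = exp (ln p / x) * u. *)
  define E where "E = (\<lambda>k x. ?c powi (- int k) * poly (exp_inv_poly k) (?c / x) * exp (- (?c / x)))"
  define U where "U = (\<lambda>k. (deriv ^^ k) (scaled_quantile p))"
  have "scaled_quantile p \<in> ?R"
    unfolding scaled_quantile_def[abs_def]
    by (intro ring_span.mult ring_span.gen) (auto simp: quantile_generators_def)
  then have U: "(U k has_real_derivative U (Suc k) t) (at t)" if "0 < t" for k t
    unfolding U_def using assms that
    by (intro has_real_derivative_higher_deriv[OF closed_under_deriv_quantile_generators])
  have E: "(E k has_real_derivative E (Suc k) t) (at t)" if "0 < t" for k t
    unfolding E_def using exp_inv_poly_Suc_derivative[OF that, of ?c k "exp_inv_rec_poly k"] assms
    by (simp only: exp_inv_poly_eq exp_inv_rec_poly.simps) simp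
  have "(deriv ^^ n) (gamma_quantile p) x = (\<Sum>k=0..n. real (n choose k) * E k x * U (n - k) x)"
  proof (rule higher_deriv_eq_tower[OF _ _ \<open>0 < x\<close>])
    show "((\<lambda>x. \<Sum>k=0..n. real (n choose k) * E k x * U (n - k) x) has_real_derivative
           (\<Sum>k=0..Suc n. real (Suc n choose k) * E k t * U (Suc n - k) t)) (at t)"
      if "0 < t" for n t
      using E U that by (intro Leibniz_tower)
    show "gamma_quantile p t = (\<Sum>k=0..0. real (0 choose k) * E k t * U (0 - k) t)" for t
      by (simp add: E_def U_def exp_inv_poly_eq scaled_quantile_def flip: exp_add)
  qed
  then show ?thesis by (simp add: E_def U_def mult.assoc)
qed

end
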